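(* If $X$ is a Rothberger space satisfying ${\sf S}_1(\mathcal{G}_K,\mathcal{G}_\Gamma)$, then $X$ is productively Rothberger and productively Gerlits–Nagy.
   Context: All spaces are infinite ${\sf T}_1$ topological spaces. $\mathcal{G}_K$ is the family of all collections $\mathcal{U}$ of ${\sf G}_\delta$ subsets of $X$ with $X\notin\mathcal{U}$ such that each compact subset of $X$ is contained in some member of $\mathcal{U}$. $\mathcal{G}_\Gamma$ is the family of infinite collections $\mathcal{U}$ of ${\sf G}_\delta$ subsets of $X$ such that every infinite subcollection covers $X$. ${\sf S}_1(\mathcal{A},\mathcal{B})$: for each sequence $(A_n)$ of elements of $\mathcal{A}$ there are $B_n\in A_n$ with $\{B_n:n\in\mathbb{N}\}\in\mathcal{B}$. $\mathcal{O}$: open covers; $\Omega$: open covers $\mathcal{U}$ with $X\notin\mathcal{U}$ such that every finite subset of $X$ lies in some member; $\mathcal{O}^{gp}$: open covers $\mathcal{U}$ admitting a partition into pairwise disjoint finite sets $\mathcal{U}_n$ ($n\in\mathbb{N}$) such that each point lies in $\bigcup\mathcal{U}_n$ for all but finitely many $n$. Rothberger means ${\sf S}_1(\mathcal{O},\mathcal{O})$; Gerlits–Nagy means ${\sf S}_1(\Omega,\mathcal{O}^{gp})$. $X$ is productively ${\sf Q}$ if $X\times Y$ has ${\sf Q}$ for every space $Y$ with ${\sf Q}$. *)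

theory Defs
  imports "HOL-Analysis.Analysis"
begin

text \<open>Standing assumption: all spaces are infinite T1 spaces.\<close>
definition inf_T1_space :: "'a topology \<Rightarrow> bool" where
  "inf_T1_space X \<longleftrightarrow> infinite (topspace X) \<and> t1_space X"

definition open_covers :: "'a topology \<Rightarrow> 'a set set \<Rightarrow> bool" where
  "open_covers X \<U> \<longleftrightarrow> (\<forall>U\<in>\<U>. openin X U) \<and> \<Union>\<U> = topspace X"

definition omega_covers :: "'a topology \<Rightarrow> 'a set set \<Rightarrow> bool" where
  "omega_covers X \<U> \<longleftrightarrow> open_covers X \<U> \<and> topspace X \<notin> \<U> \<and>
     (\<forall>F. finite F \<and> F \<subseteq> topspace X \<longrightarrow> (\<exists>U\<in>\<U>. F \<subseteq> U))"

definition gp_covers :: "'a topology \<Rightarrow> 'a set set \<Rightarrow> bool" where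
  "gp_covers X \<U> \<longleftrightarrow> open_covers X \<U> \<and>
     (\<exists>P :: nat \<Rightarrow> 'a set set.
        (\<forall>n. finite (P n)) \<and> (\<forall>n m. n \<noteq> m \<longrightarrow> P n \<inter> P m = {}) \<and>
        \<Union>(range P) = \<U> \<and>
        (\<forall>x\<in>topspace X. finite {n. x \<notin> \<Union>(P n)}))"

definition GK_covers :: "'a topology \<Rightarrow> 'a set set \<Rightarrow> bool" where
  "GK_covers X \<U> \<longleftrightarrow> (\<forall>U\<in>\<U>. gdelta_in X U) \<and> topspace X \<notin> \<U> \<and>
     (\<forall>K. compactin X K \<longrightarrow> (\<exists>U\<in>\<U>. K \<subseteq> U))"

definition GGamma_covers :: "'a topology \<Rightarrow> 'a set set \<Rightarrow> bool" where
  "GGamma_covers X \<U> \<longleftrightarrow> infinite \<U> \<and> (\<forall>U\<in>\<U>. gdelta_in X U) \<and>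
     (\<forall>\<V>. \<V> \<subseteq> \<U> \<and> infinite \<V> \<longrightarrow> topspace X \<subseteq> \<Union>\<V>)"

definition S1 :: "('a set set \<Rightarrow> bool) \<Rightarrow> ('a set set \<Rightarrow> bool) \<Rightarrow> bool" where
  "S1 \<A> \<B> \<longleftrightarrow> (\<forall>A :: nat \<Rightarrow> 'a set set. (\<forall>n. \<A> (A n)) \<longrightarrow>
      (\<exists>B :: nat \<Rightarrow> 'a set. (\<forall>n. B n \<in> A n) \<and> \<B> (range B)))"

definition rothberger :: "'a topology \<Rightarrow> bool" where
  "rothberger X \<longleftrightarrow> S1 (open_covers X) (open_covers X)"

definition gerlits_nagy :: "'a topology \<Rightarrow> bool" where
  "gerlits_nagy X \<longleftrightarrow> S1 (omega_covers X) (gp_covers X)"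

end

theory Submission
  imports Defs
begin

text \<open>
  Let \<open>K\<close> be compact in \<open>X\<close> and let \<open>Y\<close> be Rothberger. A sequence of open covers of \<open>X \<times> Y\<close> admits a
  selection covering \<open>G \<times> Y\<close> for some \<open>G\<^sub>\<delta>\<close> set \<open>G \<supseteq> K\<close>: each \<open>K \<times> {y}\<close> is covered by finitely many
  choices (only \<open>X\<close> has to be Rothberger, \<open>K\<close> need not be, as it may fail to be closed), hence so is
  a tube around it, and countably many such tubes are combined by the Rothberger property of \<open>Y\<close>.
  These \<open>G\<close> form a \<open>\<G>\<^sub>K\<close>-cover of \<open>X\<close> unless one of them is \<open>X\<close> itself, so countably many of them,
  each with its own subsequence of the covers, suffice for \<open>X \<times> Y\<close>. The same argument shows that
  \<open>X \<times> Z\<close> is Hurewicz when \<open>Z\<close> is Rothberger and Hurewicz. A Gerlits-Nagy space has both properties,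
  and conversely the two together give the Gerlits-Nagy property: spread the sequence of covers over
  infinitely many subsequences, select a cover from each, and let the Hurewicz property cut each of
  these covers down to a finite group.
\<close>

section \<open>Selection from covers described by a property\<close>

text \<open>Data attached to a selected set travel as witnesses inside \<open>P n\<close>.\<close>

lemma rothberger_select:
  fixes P :: "nat \<Rightarrow> 'a set \<Rightarrow> bool"
  assumes "rothberger Y"
    and "\<And>n y. y \<in> topspace Y \<Longrightarrow> \<exists>V. openin Y V \<and> P n V \<and> y \<in> V"
  shows "\<exists>V. (\<forall>n. openin Y (V n) \<and> P n (V n)) \<and> topspace Y \<subseteq> (\<Union>n. V n)"
proof -
  have "open_covers Y {V. openin Y V \<and> P n V}" for n
    unfolding open_covers_def using assms(2)[of _ n] by (auto dest: openin_subset)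
  then obtain V where V: "\<forall>n. V n \<in> {V. openin Y V \<and> P n V}" "open_covers Y (range V)"
    using assms(1)[unfolded rothberger_def S1_def, rule_format, of "\<lambda>n. {V. openin Y V \<and> P n V}"]
    by blast
  then show ?thesis
    by (intro exI[of _ V]) (simp add: open_covers_def)
qed

text \<open>The empty family is an open cover of the empty space, and nothing can be selected from
  it.\<close>

lemma rothberger_nonempty:
  assumes "rothberger Y"
  shows "topspace Y \<noteq> {}"
proof
  assume "topspace Y = {}"
  then show False
    using rothberger_select[OF assms, of "\<lambda>_ _. False"] by simp
qed

lemma rothbergerI:
  assumes "\<And>U. (\<And>n :: nat. open_covers Y (U n)) \<Longrightarrow>
             \<exists>B. (\<forall>n. B n \<in> U n) \<and> topspace Y \<subseteq> (\<Union>n. B n)"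
  shows "rothberger Y"
  unfolding rothberger_def S1_def
proof (intro allI impI)
  fix U :: "nat \<Rightarrow> 'a set set" assume U: "\<forall>n. open_covers Y (U n)"
  then obtain B where B: "\<forall>n. B n \<in> U n" "topspace Y \<subseteq> (\<Union>n. B n)"
    using assms by blast
  have "openin Y (B n)" for n
    using B U by (auto simp: open_covers_def)
  with B have "open_covers Y (range B)"
    unfolding open_covers_def using openin_subset by blast
  with B show "\<exists>B. (\<forall>n. B n \<in> U n) \<and> open_covers Y (range B)"
    by blast
qed

text \<open>The sets with \<open>P n\<close> form a \<open>GK_covers\<close> family unless the whole
  space is one of them. If it is for some index, that index alone covers \<open>X\<close>, and the
  others are filled arbitrarily.\<close>

lemma GK_select:
  assumes "S1 (GK_covers X) (GGamma_covers X)"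
    and "\<And>n K. compactin X K \<Longrightarrow> \<exists>G. gdelta_in X G \<and> P n G \<and> K \<subseteq> G"
  shows "\<exists>G. (\<forall>n :: nat. P n (G n)) \<and> topspace X \<subseteq> (\<Union>n. G n)"
proof (cases "\<exists>n. P n (topspace X)")
  case True
  then obtain m where m: "P m (topspace X)" ..
  have "\<exists>G. P n G" for n
    using assms(2)[of "{}" n] by auto
  then have "P n (SOME G. P n G)" for n
    by (rule someI_ex)
  with m show ?thesis
    by (intro exI[of _ "\<lambda>n. if n = m then topspace X else SOME G. P n G"]) auto
next
  case False
  then have "GK_covers X {G. gdelta_in X G \<and> P n G}" for n
    unfolding GK_covers_def using assms(2) by auto
  then obtain G where G: "\<forall>n. G n \<in> {G. gdelta_in X G \<and> P n G}" "GGamma_covers X (range G)"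
    using assms(1)[unfolded S1_def, rule_format, of "\<lambda>n. {G. gdelta_in X G \<and> P n G}"]
    by blast
  have "topspace X \<subseteq> \<Union>(range G)"
    using G(2) unfolding GGamma_covers_def by blast
  with G(1) show ?thesis
    by (intro exI[of _ G]) simp
qed

text \<open>The pairing splits the indices into rows, and a selection along each row covers
  \<open>Y\<close>. Row \<open>i\<close> has only indices at least \<open>i\<close>, so meeting
  every row gives infinitely many \<open>m\<close>.\<close>

lemma rothberger_infinitely_often:
  fixes D :: "nat \<Rightarrow> nat \<Rightarrow> 'a set"
  assumes "rothberger Y" and "\<And>m k. openin Y (D m k)"
    and "\<And>m. topspace Y \<subseteq> (\<Union>k. D m k)"
  shows "\<exists>h. \<forall>y\<in>topspace Y. \<exists>\<^sub>\<infinity>m. y \<in> D m (h m)"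
proof -
  have "\<exists>V. (\<forall>j. \<exists>k. V j = D (prod_encode (i, j)) k) \<and> topspace Y \<subseteq> (\<Union>j. V j)" for i
  proof -
    have "\<exists>V. openin Y V \<and> (\<exists>k. V = D (prod_encode (i, j)) k) \<and> y \<in> V"
      if y: "y \<in> topspace Y" for j y
    proof -
      obtain k where "y \<in> D (prod_encode (i, j)) k"
        using assms(3)[of "prod_encode (i, j)"] y by blast
      with assms(2) show ?thesis
        by (intro exI[of _ "D (prod_encode (i, j)) k"] conjI exI[of _ k] refl) simp_all
    qed
    from rothberger_select[OF assms(1), of "\<lambda>j V. \<exists>k. V = D (prod_encode (i, j)) k", OF this]
    obtain V where "(\<forall>j. openin Y (V j) \<and> (\<exists>k. V j = D (prod_encode (i, j)) k)) \<and>
        topspace Y \<subseteq> (\<Union>j. V j)" ..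
    then show ?thesis
      by (intro exI[of _ V]) simp
  qed
  then have "\<exists>V. \<forall>i. (\<forall>j. \<exists>k. V i j = D (prod_encode (i, j)) k) \<and> topspace Y \<subseteq> (\<Union>j. V i j)"
    by (intro choice allI)
  then obtain V where V: "\<forall>i. (\<forall>j. \<exists>k. V i j = D (prod_encode (i, j)) k) \<and> topspace Y \<subseteq> (\<Union>j. V i j)" ..
  define h where "h i j = (SOME k. V i j = D (prod_encode (i, j)) k)" for i j
  have h: "V i j = D (prod_encode (i, j)) (h i j)" for i j
    unfolding h_def by (rule someI_ex) (rule spec[OF conjunct1[OF spec[OF V]]])
  define h' where "h' m = (case prod_decode m of (i, j) \<Rightarrow> h i j)" for m
  have "\<exists>\<^sub>\<infinity>m. y \<in> D m (h' m)" if y: "y \<in> topspace Y" for y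
    unfolding INFM_nat_le
  proof
    fix i
    obtain j where "y \<in> V i j"
      using y conjunct2[OF spec[OF V, of i]] by blast
    then have "y \<in> D (prod_encode (i, j)) (h' (prod_encode (i, j)))"
      by (simp add: h h'_def)
    then show "\<exists>m\<ge>i. y \<in> D m (h' m)"
      using le_prod_encode_1 by blast
  qed
  then show ?thesis by blast
qed

text \<open>Greedy choice: the \<open>j\<close> earlier values exclude at most \<open>c * j\<close>
  elements, fewer than \<open>M j\<close> has.\<close>

lemma avoiding_selection:
  fixes M :: "nat \<Rightarrow> 'a set"
  assumes "\<And>j. c * j < card (M j)" and "\<And>x. finite (N x)" and "\<And>x. card (N x) \<le> c"
  shows "\<exists>f. \<forall>j. f j \<in> M j \<and> (\<forall>i<j. f j \<notin> N (f i))"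
proof -
  have "\<exists>f. \<forall>j. f j \<in> M j - (\<Union>i<j. N (f i))"
  proof (rule dependent_wellorder_choice)
    fix j and f :: "nat \<Rightarrow> 'a"
    have "card (\<Union>i<j. N (f i)) \<le> (\<Sum>i<j. card (N (f i)))"
      by (rule card_UN_le) simp
    also have "\<dots> \<le> c * j"
      using sum_bounded_above[of "{..<j}" "\<lambda>i. card (N (f i))" c] assms(3)
      by (simp add: mult.commute)
    also have "\<dots> < card (M j)"
      by (rule assms(1))
    finally have "\<not> M j \<subseteq> (\<Union>i<j. N (f i))"
      using card_mono[of "\<Union>i<j. N (f i)" "M j"] assms(2) by fastforce
    then show "\<exists>r. r \<in> M j - (\<Union>i<j. N (f i))"
      by blast
  qed auto
  then obtain f where "\<forall>j. f j \<in> M j - (\<Union>i<j. N (f i))" ..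
  then show ?thesis
    by (intro exI[of _ f]) auto
qed

section \<open>Tubes around compact sets and the Rothberger property of products\<close>

text \<open>\<open>B\<close> selects from every cover although only indices in \<open>I\<close> help
  to cover the tube; selections for disjoint index sets can then be merged.\<close>

definition tube_covered ::
  "'a topology \<Rightarrow> (nat \<Rightarrow> ('a \<times> 'b) set set) \<Rightarrow> 'a set \<Rightarrow> nat set \<Rightarrow> 'b set \<Rightarrow> bool" where
  "tube_covered X U K I V \<longleftrightarrow>
     (\<exists>B W. (\<forall>i. B i \<in> U i) \<and> openin X W \<and> K \<subseteq> W \<and> W \<times> V \<subseteq> (\<Union>i\<in>I. B i))"

lemma tube_covered_mono:
  assumes "tube_covered X U K I V" and "I \<subseteq> J" and "V' \<subseteq> V"
  shows "tube_covered X U K J V'"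
proof -
  obtain B W where BW: "\<forall>i. B i \<in> U i" "openin X W" "K \<subseteq> W" "W \<times> V \<subseteq> (\<Union>i\<in>I. B i)"
    using assms(1) unfolding tube_covered_def by (elim exE conjE)
  have "W \<times> V' \<subseteq> W \<times> V"
    using assms(3) by (rule Sigma_mono[OF order_refl])
  also note BW(4)
  also have "(\<Union>i\<in>I. B i) \<subseteq> (\<Union>i\<in>J. B i)"
    using assms(2) by (rule UN_mono) simp
  finally show ?thesis
    unfolding tube_covered_def using BW(1-3) by (intro exI[of _ B] exI[of _ W] conjI)
qed

text \<open>The traces of the covers on the slice over \<open>y\<close> are open covers of
  \<open>X\<close>. A selection from them covers \<open>X\<close>, compactness of \<open>K\<close>
  leaves finitely many indices, and the tube lemma widens \<open>K \<times> {y}\<close> to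
  \<open>W \<times> V\<close>.\<close>

lemma tube_covered_exists:
  assumes "compactin X K" and "rothberger X" and y: "y \<in> topspace Y"
    and U: "\<And>n. open_covers (prod_topology X Y) (U n)"
  shows "\<exists>k V. openin Y V \<and> y \<in> V \<and> tube_covered X U K {m..<k} V"
proof -
  have slice: "openin X {x \<in> topspace X. (x, y) \<in> B}" if "openin (prod_topology X Y) B" for B
  proof -
    have "continuous_map X (prod_topology X Y) (\<lambda>x. (x, y))"
      using y by (simp add: continuous_map_pairwise o_def)
    from openin_continuous_map_preimage[OF this that] show ?thesis .
  qed
  have "\<exists>S. openin X S \<and> (\<exists>B\<in>U (m + n). S = {x \<in> topspace X. (x, y) \<in> B}) \<and> x \<in> S"
    if "x \<in> topspace X" for n x
  proof -
    have "(x, y) \<in> \<Union>(U (m + n))"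
      using that y U[of "m + n"] by (simp add: open_covers_def)
    then obtain B where "B \<in> U (m + n)" "(x, y) \<in> B"
      by blast
    moreover from this have "openin (prod_topology X Y) B"
      using U by (auto simp: open_covers_def)
    ultimately show ?thesis
      using slice that by blast
  qed
  from rothberger_select[OF assms(2), of "\<lambda>n S. \<exists>B\<in>U (m + n). S = {x \<in> topspace X. (x, y) \<in> B}", OF this]
  obtain S where "(\<forall>n. openin X (S n) \<and> (\<exists>B\<in>U (m + n). S n = {x \<in> topspace X. (x, y) \<in> B})) \<and>
      topspace X \<subseteq> (\<Union>n. S n)" ..
  then have S: "openin X (S n)" "\<exists>B\<in>U (m + n). S n = {x \<in> topspace X. (x, y) \<in> B}"
    "topspace X \<subseteq> (\<Union>n. S n)" for n
    by simp_all
  define B' where "B' n = (SOME B. B \<in> U (m + n) \<and> S n = {x \<in> topspace X. (x, y) \<in> B})" for n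
  have "B' n \<in> U (m + n) \<and> S n = {x \<in> topspace X. (x, y) \<in> B' n}" for n
    unfolding B'_def by (rule someI_ex[OF S(2)[of n, unfolded Bex_def]])
  then have B': "B' n \<in> U (m + n)" "S n = {x \<in> topspace X. (x, y) \<in> B' n}" for n
    by simp_all
  obtain x where x: "x \<in> topspace X"
    using rothberger_nonempty[OF assms(2)] by blast
  have "U i \<noteq> {}" for i
    using U[of i] x y by (auto simp: open_covers_def)
  \<comment> \<open>Below \<open>m\<close> any member will do, since \<open>tube_covered\<close>
    asks for a total selection.\<close>
  define B where "B i = (if m \<le> i then B' (i - m) else SOME B. B \<in> U i)" for i
  have B: "B i \<in> U i" for i
    using B'(1)[of "i - m"] \<open>U i \<noteq> {}\<close> some_in_eq[of "U i"] by (auto simp: B_def)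
  have "K \<subseteq> \<Union>(range S)"
    using compactin_subset_topspace[OF assms(1)] S(3) by simp
  moreover have "\<forall>T\<in>range S. openin X T"
    using S(1) by blast
  ultimately obtain F where F: "finite F" "F \<subseteq> range S" "K \<subseteq> \<Union>F"
    using assms(1) unfolding compactin_def by meson
  then obtain A where A: "finite A" "F = S ` A"
    by (meson finite_subset_image)
  \<comment> \<open>\<open>insert 0\<close> gives \<open>Max\<close> a value for empty
    \<open>A\<close>; \<open>Suc\<close> is due to the half-open interval.\<close>
  define k where "k = m + Suc (Max (insert 0 A))"
  have "K \<times> {y} \<subseteq> (\<Union>i\<in>{m..<k}. B i)"
  proof clarify
    fix x assume "x \<in> K"
    then obtain n where n: "n \<in> A" "x \<in> S n"
      using F A by blast
    then have "n \<le> Max (insert 0 A)"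
      using A by simp
    then have "m + n \<in> {m..<k}"
      by (simp add: k_def)
    moreover have "(x, y) \<in> B (m + n)"
      using n B' by (simp add: B_def)
    ultimately show "(x, y) \<in> (\<Union>i\<in>{m..<k}. B i)"
      by blast
  qed
  moreover have "openin (prod_topology X Y) (B i)" for i
    using U[of i] B[of i] by (simp add: open_covers_def)
  then have "openin (prod_topology X Y) (\<Union>i\<in>{m..<k}. B i)"
    by (intro openin_Union) auto
  ultimately obtain W V where "openin X W" "openin Y V" "K \<subseteq> W" "{y} \<subseteq> V"
      "W \<times> V \<subseteq> (\<Union>i\<in>{m..<k}. B i)"
    using Wallace_theorem_prod_topology[OF assms(1), of Y "{y}" "\<Union>i\<in>{m..<k}. B i"] y
    by auto
  with B have "tube_covered X U K {m..<k} V"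
    unfolding tube_covered_def by (intro exI[of _ B] exI[of _ W]) simp
  with \<open>openin Y V\<close> \<open>{y} \<subseteq> V\<close> show ?thesis
    by blast
qed

text \<open>The end \<open>k\<close> in \<open>tube_covered_exists\<close> depends on
  \<open>y\<close>. By \<open>rothberger_infinitely_often\<close> a function \<open>h\<close> of
  \<open>m\<close> alone serves each \<open>y\<close> infinitely often, and cut points
  \<open>t\<close> growing faster than \<open>h\<close> put \<open>{m..<h m}\<close> into two
  consecutive pieces.\<close>

lemma rothberger_tube_blocks:
  assumes "compactin X K" and "rothberger X" and "rothberger Y"
    and U: "\<And>n :: nat. open_covers (prod_topology X Y) (U n)"
  shows "\<exists>t :: nat \<Rightarrow> nat. strict_mono t \<and> (\<forall>y\<in>topspace Y.
           \<exists>\<^sub>\<infinity>n. \<exists>V. openin Y V \<and> y \<in> V \<and> tube_covered X U K {t n..<t (n + 2)} V)"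
proof -
  define D where "D m k = \<Union>{V. openin Y V \<and> tube_covered X U K {m..<k} V}" for m k :: nat
  have "openin Y (D m k)" for m k
    unfolding D_def by auto
  moreover have "topspace Y \<subseteq> (\<Union>k. D m k)" for m
  proof
    fix y assume "y \<in> topspace Y"
    then obtain k V where "openin Y V" "y \<in> V" "tube_covered X U K {m..<k} V"
      using tube_covered_exists[where U = U and m = m, OF assms(1,2) _ U] by blast
    then show "y \<in> (\<Union>k. D m k)"
      unfolding D_def by blast
  qed
  ultimately have "\<exists>h. \<forall>y\<in>topspace Y. \<exists>\<^sub>\<infinity>m. y \<in> D m (h m)"
    by (rule rothberger_infinitely_often[OF assms(3)])
  then obtain h where h: "\<forall>y\<in>topspace Y. \<exists>\<^sub>\<infinity>m. y \<in> D m (h m)" ..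
  \<comment> \<open>The sum dominates every \<open>h m\<close> with \<open>m \<le> t n\<close>, so
    an interval that starts in the \<open>n\<close>-th piece ends by
    \<open>t (n + 2)\<close>.\<close>
  define t where "t = rec_nat 0 (\<lambda>_ a. Suc (a + (\<Sum>m\<le>a. h m)))"
  have t: "t 0 = 0" "t (Suc n) = Suc (t n + (\<Sum>m\<le>t n. h m))" for n
    by (simp_all add: t_def)
  have mono: "strict_mono t"
    unfolding strict_mono_Suc_iff by (simp add: t(2))
  have "\<exists>\<^sub>\<infinity>n. \<exists>V. openin Y V \<and> y \<in> V \<and> tube_covered X U K {t n..<t (n + 2)} V"
    if y: "y \<in> topspace Y" for y
    unfolding INFM_nat_le
  proof
    fix N
    obtain m where m: "t N \<le> m" "y \<in> D m (h m)"
      using bspec[OF h y] unfolding INFM_nat_le by blast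
    \<comment> \<open>The piece in which \<open>m\<close> lies.\<close>
    define n where "n = (GREATEST n. t n \<le> m)"
    have bound: "t n \<le> m \<Longrightarrow> n \<le> m" for n
      using strict_mono_imp_increasing[OF mono, of n] by simp
    have n: "t n \<le> m"
      unfolding n_def by (rule GreatestI_nat[where P = "\<lambda>n. t n \<le> m", OF m(1) bound])
    have n_max: "k \<le> n" if "t k \<le> m" for k
      unfolding n_def by (rule Greatest_le_nat[where P = "\<lambda>n. t n \<le> m", OF that bound])
    have N: "N \<le> n"
      by (rule n_max[OF m(1)])
    have "m \<le> t (Suc n)"
      using n_max[of "Suc n"] by linarith
    then have "h m \<le> (\<Sum>m\<le>t (Suc n). h m)"
      using member_le_sum[of m "{..t (Suc n)}" h] by simp
    also have "\<dots> \<le> t (n + 2)"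
      by (simp add: t(2)[of "Suc n"])
    finally have "{m..<h m} \<subseteq> {t n..<t (n + 2)}"
      using n by (intro ivl_subset[THEN iffD2] disjI2 conjI)
    moreover obtain V where "openin Y V" "y \<in> V" "tube_covered X U K {m..<h m} V"
      using m(2) unfolding D_def by blast
    ultimately have "tube_covered X U K {t n..<t (n + 2)} V"
      by (blast intro: tube_covered_mono)
    with N \<open>openin Y V\<close> \<open>y \<in> V\<close>
    show "\<exists>n\<ge>N. \<exists>V. openin Y V \<and> y \<in> V \<and> tube_covered X U K {t n..<t (n + 2)} V"
      by (intro exI[of _ n] conjI exI[of _ V])
  qed
  with mono show ?thesis by blast
qed

text \<open>Countably many tubes \<open>W j \<times> V j\<close>, with the \<open>V j\<close>
  covering \<open>Y\<close>, are covered from pairwise disjoint blocks of indices, so their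
  selections do not compete. The intersection of the \<open>W j\<close> serves as
  \<open>G\<close>.\<close>

lemma rothberger_cover_gdelta:
  fixes Y :: "'b topology"
  assumes "compactin X K" and "rothberger X" and "rothberger Y"
    and U: "\<And>n :: nat. open_covers (prod_topology X Y) (U n)"
  shows "\<exists>G B. gdelta_in X G \<and> K \<subseteq> G \<and> (\<forall>n. B n \<in> U n) \<and> G \<times> topspace Y \<subseteq> (\<Union>n. B n)"
proof -
  obtain t :: "nat \<Rightarrow> nat" where t: "strict_mono t"
    "\<forall>y\<in>topspace Y.
       \<exists>\<^sub>\<infinity>n. \<exists>V. openin Y V \<and> y \<in> V \<and> tube_covered X U K {t n..<t (n + 2)} V"
    using rothberger_tube_blocks[where U = U, OF assms] by blast
  \<comment> \<open>The blocks overlap only for neighbouring indices. Each of \<open>j\<close> earlier choices excludes three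
    indices, so \<open>3 * j + 1\<close> candidates for the \<open>j\<close>-th set leave one whose block is disjoint from the
    earlier ones.\<close>
  let ?P = "\<lambda>j V. \<exists>M. card M = 3 * j + 1 \<and> (\<forall>n\<in>M. tube_covered X U K {t n..<t (n + 2)} V)"
  have "\<exists>V. openin Y V \<and> ?P j V \<and> y \<in> V" if y: "y \<in> topspace Y" for j y
  proof -
    have "infinite {n. \<exists>V. openin Y V \<and> y \<in> V \<and> tube_covered X U K {t n..<t (n + 2)} V}"
      using bspec[OF t(2) y] by (simp add: INFM_iff_infinite)
    then obtain M where M: "finite M" "card M = 3 * j + 1"
      "M \<subseteq> {n. \<exists>V. openin Y V \<and> y \<in> V \<and> tube_covered X U K {t n..<t (n + 2)} V}"
      by (meson infinite_arbitrarily_large)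
    then have "\<forall>n\<in>M. \<exists>V. openin Y V \<and> y \<in> V \<and> tube_covered X U K {t n..<t (n + 2)} V"
      by blast
    from bchoice[OF this] obtain V where V:
      "\<forall>n\<in>M. openin Y (V n) \<and> y \<in> V n \<and> tube_covered X U K {t n..<t (n + 2)} (V n)" ..
    have "M \<noteq> {}"
      using M(2) by auto
    \<comment> \<open>One neighbourhood of \<open>y\<close> thus serves all candidate blocks, and
      the choice among them can wait until \<open>V j\<close> is fixed.\<close>
    then have "openin Y (\<Inter>n\<in>M. V n)"
      using V M(1) by (intro openin_INT2) auto
    moreover have "\<forall>n\<in>M. tube_covered X U K {t n..<t (n + 2)} (\<Inter>n\<in>M. V n)"
      using V by (blast intro: tube_covered_mono)
    moreover have "y \<in> (\<Inter>n\<in>M. V n)"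
      using V by blast
    ultimately show ?thesis
      using M(2) by (intro exI[of _ "\<Inter>n\<in>M. V n"] conjI exI[of _ M])
  qed
  from rothberger_select[OF assms(3), of ?P, OF this]
  obtain V where V: "\<forall>j. ?P j (V j)" "topspace Y \<subseteq> (\<Union>j. V j)"
    by blast
  from choice[OF V(1)] obtain M where M: "\<And>j. card (M j) = 3 * j + 1"
    "\<And>j n. n \<in> M j \<Longrightarrow> tube_covered X U K {t n..<t (n + 2)} (V j)"
    by blast
  have "\<exists>f. \<forall>j. f j \<in> M j \<and> (\<forall>i<j. f j \<notin> {f i - 1, f i, f i + 1})"
    by (rule avoiding_selection[of 3]) (simp_all add: M(1) card_insert_if)
  then obtain f where f: "\<And>j. f j \<in> M j" "\<And>i j. i < j \<Longrightarrow> f j \<notin> {f i - 1, f i, f i + 1}"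
    by blast
  define J where "J j = {t (f j)..<t (f j + 2)}" for j
  have disj: "J i \<inter> J j = {}" if "i < j" for i j
  proof -
    have "f i + 2 \<le> f j \<or> f j + 2 \<le> f i"
      using f(2)[OF that] by auto
    then have "t (f i + 2) \<le> t (f j) \<or> t (f j + 2) \<le> t (f i)"
      using t(1) by (simp add: strict_mono_less_eq)
    then show ?thesis
      by (auto simp: J_def)
  qed
  have unique: "i = j" if "n \<in> J i" "n \<in> J j" for i j n
    using disj[of i j] disj[of j i] that by (cases i j rule: linorder_cases) auto
  have "\<forall>j. tube_covered X U K (J j) (V j)"
    unfolding J_def using M(2)[OF f(1)] by blast
  then obtain B W where BW: "\<forall>j. (\<forall>i. B j i \<in> U i) \<and> openin X (W j) \<and> K \<subseteq> W j \<and>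
      W j \<times> V j \<subseteq> (\<Union>i\<in>J j. B j i)"
    unfolding tube_covered_def choice_iff by blast
  \<comment> \<open>Outside all blocks \<open>SOME\<close> yields an unspecified \<open>j\<close>,
    but \<open>B j i\<close> is still a member of \<open>U i\<close>.\<close>
  define B' where "B' i = B (SOME j. i \<in> J j) i" for i
  have B': "B' i = B j i" if "i \<in> J j" for i j
    using unique[OF that someI[of "\<lambda>j. i \<in> J j", OF that]] by (simp add: B'_def)
  show ?thesis
  proof (intro exI conjI allI)
    show "gdelta_in X (\<Inter>j. W j)"
      using BW by (intro gdelta_in_Inter) (auto simp: open_imp_gdelta_in)
    show "K \<subseteq> (\<Inter>j. W j)"
      using BW by blast
    show "B' n \<in> U n" for n
      using BW by (simp add: B'_def)
    show "(\<Inter>j. W j) \<times> topspace Y \<subseteq> (\<Union>n. B' n)"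
    proof clarify
      fix x y assume x: "x \<in> (\<Inter>j. W j)" and "y \<in> topspace Y"
      then obtain j where "y \<in> V j"
        using V(2) by blast
      then have "(x, y) \<in> W j \<times> V j"
        using x by blast
      then obtain i where "i \<in> J j" "(x, y) \<in> B j i"
        using BW by blast
      then show "(x, y) \<in> (\<Union>n. B' n)"
        using B' by blast
    qed
  qed
qed

lemma rothberger_prod_topology:
  fixes Y :: "'b topology"
  assumes "rothberger X" and "S1 (GK_covers X) (GGamma_covers X)" and "rothberger Y"
  shows "rothberger (prod_topology X Y)"
proof (rule rothbergerI)
  fix U :: "nat \<Rightarrow> ('a \<times> 'b) set set"
  assume U: "\<And>n. open_covers (prod_topology X Y) (U n)"
  define P where "P i G \<longleftrightarrow>
    (\<exists>B. (\<forall>j. B j \<in> U (prod_encode (i, j))) \<and> G \<times> topspace Y \<subseteq> (\<Union>j. B j))" for i :: nat and G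
  have P: "\<exists>G. gdelta_in X G \<and> P i G \<and> K \<subseteq> G" if "compactin X K" for i K
    using rothberger_cover_gdelta[where U = "\<lambda>j. U (prod_encode (i, j))", OF that assms(1,3) U]
    unfolding P_def by blast
  from GK_select[OF assms(2), of P, OF P]
  obtain G where "(\<forall>i. P i (G i)) \<and> topspace X \<subseteq> (\<Union>i. G i)" ..
  then have G: "P i (G i)" "topspace X \<subseteq> (\<Union>i. G i)" for i
    by simp_all
  define B where "B i = (SOME B. (\<forall>j. B j \<in> U (prod_encode (i, j))) \<and>
      G i \<times> topspace Y \<subseteq> (\<Union>j. B j))" for i
  have "(\<forall>j. B i j \<in> U (prod_encode (i, j))) \<and> G i \<times> topspace Y \<subseteq> (\<Union>j. B i j)" for i
    unfolding B_def by (rule someI_ex[OF G(1)[unfolded P_def]])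
  then have B: "B i j \<in> U (prod_encode (i, j))" "G i \<times> topspace Y \<subseteq> (\<Union>j. B i j)" for i j
    by simp_all
  define B' where "B' n = (case prod_decode n of (i, j) \<Rightarrow> B i j)" for n
  have B'_eq: "B' (prod_encode (i, j)) = B i j" for i j
    by (simp add: B'_def)
  have "B' n \<in> U n" for n
    using B(1)[of "fst (prod_decode n)" "snd (prod_decode n)"] by (simp add: B'_def case_prod_beta)
  moreover have "topspace (prod_topology X Y) \<subseteq> (\<Union>n. B' n)"
  proof
    fix z assume "z \<in> topspace (prod_topology X Y)"
    then obtain x y where z: "z = (x, y)" "x \<in> topspace X" "y \<in> topspace Y"
      by auto
    then obtain i where "x \<in> G i"
      using G(2) by blast
    with z have "z \<in> G i \<times> topspace Y"
      by simp
    then obtain j where "z \<in> B i j"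
      using B(2)[of i] by blast
    then show "z \<in> (\<Union>n. B' n)"
      unfolding B'_eq[symmetric] by (rule UN_I[OF UNIV_I])
  qed
  ultimately show "\<exists>B. (\<forall>n. B n \<in> U n) \<and> topspace (prod_topology X Y) \<subseteq> (\<Union>n. B n)"
    by (intro exI[of _ B'] conjI allI)
qed

section \<open>Gerlits-Nagy spaces are Rothberger and Hurewicz\<close>

text \<open>The analogue of \<open>GK_select\<close> with finite sets and omega-covers.\<close>

lemma gerlits_nagy_select:
  fixes P :: "nat \<Rightarrow> 'a set \<Rightarrow> bool"
  assumes "gerlits_nagy Z"
    and P: "\<And>n F. finite F \<Longrightarrow> F \<subseteq> topspace Z \<Longrightarrow> \<exists>V. openin Z V \<and> P n V \<and> F \<subseteq> V"
  shows "\<exists>V. (\<forall>n. P n (V n)) \<and> topspace Z \<subseteq> (\<Union>n. V n)"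
proof (cases "\<exists>n. P n (topspace Z)")
  case True
  then obtain m where m: "P m (topspace Z)" ..
  have "\<exists>V. P n V" for n
    using P[of "{}" n] by auto
  then have "P n (SOME V. P n V)" for n
    by (rule someI_ex)
  with m show ?thesis
    by (intro exI[of _ "\<lambda>n. if n = m then topspace Z else SOME V. P n V"]) auto
next
  case False
  have "omega_covers Z {V. openin Z V \<and> P n V}" for n
  proof -
    have "x \<in> \<Union>{V. openin Z V \<and> P n V}" if "x \<in> topspace Z" for x
      using P[of "{x}" n] that by auto
    then have "open_covers Z {V. openin Z V \<and> P n V}"
      unfolding open_covers_def by (auto dest: openin_subset)
    then show ?thesis
      unfolding omega_covers_def using False P[of _ n] by auto
  qed
  then obtain V where V: "\<forall>n. V n \<in> {V. openin Z V \<and> P n V}" "gp_covers Z (range V)"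
    using assms(1)[unfolded gerlits_nagy_def S1_def, rule_format, of "\<lambda>n. {V. openin Z V \<and> P n V}"]
    by blast
  have "topspace Z \<subseteq> \<Union>(range V)"
    by (rule equalityD2[OF conjunct2[OF conjunct1[OF V(2)[unfolded gp_covers_def open_covers_def]]]])
  with V(1) show ?thesis
    by (intro exI[of _ V]) simp
qed

text \<open>Unions of selections along a row of the pairing catch every finite set; one union per
  row is chosen so that they cover \<open>Z\<close>, and then unfolded. The empty space has no
  omega-covers, so it is Gerlits-Nagy but, by \<open>rothberger_nonempty\<close>, not Rothberger;
  the second assumption excludes it.\<close>

lemma gerlits_nagy_imp_rothberger:
  assumes "gerlits_nagy Z" and "topspace Z \<noteq> {}"
  shows "rothberger Z"
proof (rule rothbergerI)
  fix U :: "nat \<Rightarrow> 'a set set"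
  assume U: "\<And>n. open_covers Z (U n)"
  define P where "P j V \<longleftrightarrow> (\<exists>b. (\<forall>i. b i \<in> U (prod_encode (j, i))) \<and> V \<subseteq> (\<Union>i. b i))" for j V
  have pick: "\<exists>B\<in>U n. x \<in> B" if "x \<in> topspace Z" for n x
    using U[of n] that unfolding open_covers_def by blast
  have P: "\<exists>V. openin Z V \<and> P j V \<and> F \<subseteq> V" if F: "finite F" "F \<subseteq> topspace Z" for j F
  proof -
    obtain x0 where x0: "x0 \<in> topspace Z"
      using assms(2) by blast
    \<comment> \<open>An infinite union is taken although \<open>F\<close> is finite; \<open>e\<close> enumerates \<open>F\<close> with repetitions.\<close>
    define e where "e i = (if F = {} then x0 else from_nat_into F i)" for i
    have e: "e i \<in> topspace Z" for i
      using F(2) x0 from_nat_into[of F i] by (auto simp: e_def)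
    define b where "b i = (SOME B. B \<in> U (prod_encode (j, i)) \<and> e i \<in> B)" for i
    have "b i \<in> U (prod_encode (j, i)) \<and> e i \<in> b i" for i
      unfolding b_def by (rule someI_ex) (use pick[OF e] in blast)
    then have b: "b i \<in> U (prod_encode (j, i))" "e i \<in> b i" for i
      by simp_all
    have "openin Z (b i)" for i
      using b(1)[of i] U[of "prod_encode (j, i)"] unfolding open_covers_def by blast
    then have "openin Z (\<Union>i. b i)"
      by (intro openin_Union) auto
    moreover have "P j (\<Union>i. b i)"
      unfolding P_def using b(1) by (intro exI[of _ b]) simp
    moreover have "F \<subseteq> (\<Union>i. b i)"
    proof
      fix x assume x: "x \<in> F"
      then have "e (to_nat_on F x) = x"
        using F(1) by (auto simp: e_def countable_finite)
      then show "x \<in> (\<Union>i. b i)"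
        using b(2)[of "to_nat_on F x"] by auto
    qed
    ultimately show ?thesis
      by blast
  qed
  from gerlits_nagy_select[OF assms(1), of P, OF P]
  obtain V where "(\<forall>n. P n (V n)) \<and> topspace Z \<subseteq> (\<Union>n. V n)" ..
  then have V: "P n (V n)" "topspace Z \<subseteq> (\<Union>n. V n)" for n
    by simp_all
  define b where "b j = (SOME b. (\<forall>i. b i \<in> U (prod_encode (j, i))) \<and> V j \<subseteq> (\<Union>i. b i))" for j
  have "(\<forall>i. b j i \<in> U (prod_encode (j, i))) \<and> V j \<subseteq> (\<Union>i. b j i)" for j
    unfolding b_def by (rule someI_ex[OF V(1)[unfolded P_def]])
  then have b: "b j i \<in> U (prod_encode (j, i))" "V j \<subseteq> (\<Union>i. b j i)" for i j
    by simp_all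
  define B where "B n = (case prod_decode n of (j, i) \<Rightarrow> b j i)" for n
  have B_eq: "B (prod_encode (j, i)) = b j i" for i j
    by (simp add: B_def)
  have "B n \<in> U n" for n
    using b(1)[of "fst (prod_decode n)" "snd (prod_decode n)"] by (simp add: B_def case_prod_beta)
  moreover have "topspace Z \<subseteq> (\<Union>n. B n)"
  proof
    fix x assume "x \<in> topspace Z"
    then obtain j where "x \<in> V j"
      using V(2) by blast
    then obtain i where "x \<in> b j i"
      using b(2)[of j] by blast
    then show "x \<in> (\<Union>n. B n)"
      unfolding B_eq[symmetric] by (rule UN_I[OF UNIV_I])
  qed
  ultimately show "\<exists>B. (\<forall>n. B n \<in> U n) \<and> topspace Z \<subseteq> (\<Union>n. B n)"
    by (intro exI[of _ B] conjI allI)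
qed

text \<open>Only countable covers are considered: the usual Hurewicz property is this one together with
  the Lindelof property.\<close>
definition hurewicz :: "'a topology \<Rightarrow> bool" where
  "hurewicz X \<longleftrightarrow> (\<forall>U :: nat \<Rightarrow> nat \<Rightarrow> 'a set.
     (\<forall>n k. openin X (U n k)) \<and> (\<forall>n. topspace X \<subseteq> (\<Union>k. U n k)) \<longrightarrow>
     (\<exists>g. \<forall>x\<in>topspace X. finite {n. x \<notin> (\<Union>k\<le>g n. U n k)}))"

text \<open>Intersecting the partial unions \<open>E i k\<close> over several \<open>i\<close> gives
  omega-covers \<open>T p\<close> whose members lie in some \<open>E n k\<close> for every
  \<open>n\<close> in \<open>I p\<close>. A finite group of sets from covers later than the
  \<open>n\<close>-th therefore lies in a single \<open>E n (g n)\<close>, and almost all groups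
  contain a given point.\<close>

lemma gerlits_nagy_imp_hurewicz:
  assumes "gerlits_nagy Z"
  shows "hurewicz Z"
  unfolding hurewicz_def
proof (intro allI impI, elim conjE)
  fix U :: "nat \<Rightarrow> nat \<Rightarrow> 'a set"
  assume U: "\<forall>n k. openin Z (U n k)" "\<forall>n. topspace Z \<subseteq> (\<Union>k. U n k)"
  define E where "E n k = (\<Union>i\<le>k. U n i)" for n k
  have E_mono: "E n k \<subseteq> E n l" if "k \<le> l" for n k l
    unfolding E_def using that by (intro UN_mono) auto
  have E_open: "openin Z (E n k)" for n k
    unfolding E_def using U(1) by (intro openin_Union) auto
  have E_finite: "\<exists>k. F \<subseteq> E n k" if "finite F" "F \<subseteq> topspace Z" for n F
    using that
  proof (induction F rule: finite_induct)
    case (insert x F)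
    then obtain k l where "F \<subseteq> E n k" "x \<in> U n l"
      using U(2) by blast
    moreover have "U n l \<subseteq> E n l"
      unfolding E_def by blast
    ultimately have "insert x F \<subseteq> E n (max k l)"
      using E_mono[of k "max k l" n] E_mono[of l "max k l" n] by auto
    then show ?case ..
  qed simp
  define full where "full n \<longleftrightarrow> (\<exists>k. topspace Z \<subseteq> E n k)" for n
  show "\<exists>g. \<forall>x\<in>topspace Z. finite {n. x \<notin> (\<Union>k\<le>g n. U n k)}"
    unfolding E_def[symmetric]
  proof (cases "\<forall>n. full n")
    case True
    then obtain g where "\<forall>n. topspace Z \<subseteq> E n (g n)"
      unfolding full_def by (auto dest: choice)
    then have "\<forall>x\<in>topspace Z. {n. x \<notin> E n (g n)} = {}"
      by blast
    then show "\<exists>g. \<forall>x\<in>topspace Z. finite {n. x \<notin> E n (g n)}"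
      by (intro exI[of _ g]) simp
  next
    case False
    then obtain n0 where n0: "\<not> full n0"
      by blast
    \<comment> \<open>The indices with \<open>full i\<close> are left out and \<open>n0\<close> is kept, so that the whole space is never a
      member of the \<open>n\<close>-th cover.\<close>
    define I where "I n = {i \<in> {n0..n0 + n}. \<not> full i}" for n
    have I: "finite (I n)" "n0 \<in> I n" for n
      using n0 by (auto simp: I_def)
    define T where "T n k = (\<Inter>i\<in>I n. E i k)" for n k
    have T_finite: "\<exists>k. F \<subseteq> T n k" if F: "finite F" "F \<subseteq> topspace Z" for n F
    proof -
      obtain \<kappa> where \<kappa>: "\<And>i. F \<subseteq> E i (\<kappa> i)"
        using E_finite[OF F] by metis
      have "F \<subseteq> E i (Max (\<kappa> ` I n))" if "i \<in> I n" for i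
        using \<kappa>[of i] E_mono[of "\<kappa> i" "Max (\<kappa> ` I n)" i] I(1) that by fastforce
      then show ?thesis
        unfolding T_def by blast
    qed
    have "omega_covers Z (range (T n))" for n
    proof -
      have T_open: "openin Z (T n k)" for k
        unfolding T_def using I[of n] E_open by (intro openin_INT2) auto
      have "topspace Z \<subseteq> \<Union>(range (T n))"
        using T_finite[of "{x}" n for x] by auto
      then have "open_covers Z (range (T n))"
        unfolding open_covers_def using T_open openin_subset by blast
      moreover have "T n k \<subseteq> E n0 k" for k
        unfolding T_def using I(2) by blast
      then have "topspace Z \<notin> range (T n)"
        using n0 unfolding full_def by (metis rangeE)
      ultimately show ?thesis
        unfolding omega_covers_def using T_finite[of _ n] by auto
    qed
    then obtain B where B: "\<forall>n. B n \<in> range (T n)" "gp_covers Z (range B)"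
      using assms[unfolded gerlits_nagy_def S1_def, rule_format, of "\<lambda>n. range (T n)"] by blast
    obtain P :: "nat \<Rightarrow> 'a set set" where P: "\<forall>j. finite (P j)" "\<forall>i j. i \<noteq> j \<longrightarrow> P i \<inter> P j = {}"
      "\<Union>(range P) = range B" "\<forall>x\<in>topspace Z. finite {j. x \<notin> \<Union>(P j)}"
      using B(2) unfolding gp_covers_def by (elim conjE exE)
    \<comment> \<open>The groups are disjoint, so the finitely many sets \<open>B 0\<close>, ...,
      \<open>B n\<close> occur in only finitely many of them.\<close>
    have J_ex: "\<exists>j\<ge>n. P j \<inter> B ` {..n} = {}" for n
    proof -
      have "finite {j. C \<in> P j}" for C
      proof (cases "\<exists>j. C \<in> P j")
        case True
        then obtain j where "C \<in> P j" ..
        then have "{j. C \<in> P j} \<subseteq> {j}"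
          using P(2) by blast
        then show ?thesis
          by (rule finite_subset) simp
      qed simp
      then have "finite (\<Union>C\<in>B ` {..n}. {j. C \<in> P j})"
        by simp
      then have "infinite ({n..} - (\<Union>C\<in>B ` {..n}. {j. C \<in> P j}))"
        by (simp add: Diff_infinite_finite infinite_Ici)
      then obtain j where "j \<in> {n..} - (\<Union>C\<in>B ` {..n}. {j. C \<in> P j})"
        using infinite_imp_nonempty by blast
      then have "n \<le> j" "P j \<inter> B ` {..n} = {}"
        by auto
      then show ?thesis
        by blast
    qed
    define J where "J n = (SOME j. n \<le> j \<and> P j \<inter> B ` {..n} = {})" for n
    have "n \<le> J n \<and> P (J n) \<inter> B ` {..n} = {}" for n
      unfolding J_def by (rule someI_ex[OF J_ex])
    then have J: "n \<le> J n" "P (J n) \<inter> B ` {..n} = {}" for n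
      by simp_all
    have "\<exists>k. \<Union>(P (J n)) \<inter> topspace Z \<subseteq> E n k" if n: "n0 \<le> n" for n
    proof (cases "full n")
      case True
      then show ?thesis
        unfolding full_def by blast
    next
      case nfull: False
      have "\<exists>k. C \<subseteq> E n k" if C: "C \<in> P (J n)" for C
      proof -
        have "C \<in> range B"
          using P(3) C by blast
        then obtain p where p: "C = B p"
          by blast
        with C J(2)[of n] have "n < p"
          by (meson disjoint_iff image_eqI atMost_iff not_le)
        then have "n \<in> I p"
          using n nfull by (simp add: I_def)
        moreover obtain k where "C = T p k"
          using B(1) p by blast
        ultimately show ?thesis
          unfolding T_def by blast
      qed
      then obtain \<kappa> where \<kappa>: "\<forall>C\<in>P (J n). C \<subseteq> E n (\<kappa> C)"
        by metis
      have "C \<subseteq> E n (Max (\<kappa> ` P (J n)))" if C: "C \<in> P (J n)" for C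
        using bspec[OF \<kappa> C] E_mono[of "\<kappa> C" "Max (\<kappa> ` P (J n))" n] P(1) C by fastforce
      then show ?thesis
        by blast
    qed
    then obtain g where g: "\<And>n. n0 \<le> n \<Longrightarrow> \<Union>(P (J n)) \<inter> topspace Z \<subseteq> E n (g n)"
      by metis
    have "finite {n. x \<notin> E n (g n)}" if x: "x \<in> topspace Z" for x
    proof -
      have fin: "finite {j. x \<notin> \<Union>(P j)}"
        using P(4) x by blast
      \<comment> \<open>For \<open>n \<ge> n0\<close> a miss at \<open>n\<close> makes the group
        \<open>J n\<close> miss \<open>x\<close>; there are finitely many such groups, and
        \<open>n \<le> J n\<close> bounds \<open>n\<close>.\<close>
      have "{n. x \<notin> E n (g n)} \<subseteq> {..<n0} \<union> (\<Union>j\<in>{j. x \<notin> \<Union>(P j)}. {..j})"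
      proof
        fix n assume "n \<in> {n. x \<notin> E n (g n)}"
        then have "n < n0 \<or> x \<notin> \<Union>(P (J n))"
          using g[of n] x by (cases "n0 \<le> n") auto
        then show "n \<in> {..<n0} \<union> (\<Union>j\<in>{j. x \<notin> \<Union>(P j)}. {..j})"
          using J(1)[of n] by auto
      qed
      then show ?thesis
        by (rule finite_subset) (intro finite_UnI finite_UN_I fin finite_lessThan finite_atMost)
    qed
    then show "\<exists>g. \<forall>x\<in>topspace Z. finite {n. x \<notin> E n (g n)}"
      by blast
  qed
qed

section \<open>The Hurewicz property of products\<close>

text \<open>A tube around \<open>K \<times> {z}\<close> needs finitely many sets of the
  \<open>n\<close>-th cover. The Rothberger property leaves countably many \<open>V n j\<close>, the
  Hurewicz property bounds \<open>j\<close> by \<open>g n\<close>, and \<open>g' n\<close> is the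
  largest \<open>\<kappa> n j\<close> among these. Over the intersection of all \<open>W n j\<close>
  the exceptions for \<open>(x, z)\<close> are exceptions for \<open>z\<close>.\<close>

lemma hurewicz_cover_gdelta:
  fixes Z :: "'b topology" and U :: "nat \<Rightarrow> nat \<Rightarrow> ('a \<times> 'b) set"
  assumes K: "compactin X K" and "rothberger Z" and "hurewicz Z"
    and U: "\<And>n k. openin (prod_topology X Z) (U n k)"
      "\<And>n. topspace (prod_topology X Z) \<subseteq> (\<Union>k. U n k)"
  shows "\<exists>G. gdelta_in X G \<and> K \<subseteq> G \<and>
    (\<exists>g. \<forall>x\<in>G. \<forall>z\<in>topspace Z. finite {n. (x, z) \<notin> (\<Union>k\<le>g n. U n k)})"
proof -
  define Q where "Q n V W k \<longleftrightarrow> openin X W \<and> K \<subseteq> W \<and> W \<times> V \<subseteq> (\<Union>i\<le>k. U n i)" for n V W and k :: nat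
  have tube: "\<exists>V. openin Z V \<and> (\<exists>W k. Q n V W k) \<and> z \<in> V" if z: "z \<in> topspace Z" for n z
  proof -
    have "compactin (prod_topology X Z) (K \<times> {z})"
      using K z by (simp add: compactin_Times)
    moreover have "K \<times> {z} \<subseteq> \<Union>(range (U n))"
      using U(2)[of n] z compactin_subset_topspace[OF K] by auto
    moreover have "\<forall>T\<in>range (U n). openin (prod_topology X Z) T"
      using U(1) by blast
    ultimately obtain F where F: "finite F" "F \<subseteq> range (U n)" "K \<times> {z} \<subseteq> \<Union>F"
      unfolding compactin_def by meson
    then obtain A where A: "finite A" "F = U n ` A"
      by (meson finite_subset_image)
    have "\<Union>F \<subseteq> (\<Union>i\<le>Max A. U n i)"
      unfolding A(2) using A(1) by (intro UN_mono) auto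
    with F(3) have "K \<times> {z} \<subseteq> (\<Union>i\<le>Max A. U n i)"
      by (rule subset_trans)
    moreover have "openin (prod_topology X Z) (\<Union>i\<le>Max A. U n i)"
      using U(1) by (intro openin_Union) auto
    ultimately obtain W V where "openin X W" "openin Z V" "K \<subseteq> W" "{z} \<subseteq> V"
        "W \<times> V \<subseteq> (\<Union>i\<le>Max A. U n i)"
      using Wallace_theorem_prod_topology[OF K, of Z "{z}" "\<Union>i\<le>Max A. U n i"] z by auto
    then show ?thesis
      unfolding Q_def by (intro exI[of _ V] conjI exI[of _ W] exI[of _ "Max A"]) auto
  qed
  have "\<exists>V :: nat \<Rightarrow> 'b set. (\<forall>j. openin Z (V j) \<and> (\<exists>W k. Q n (V j) W k)) \<and> topspace Z \<subseteq> (\<Union>j. V j)" for n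
    by (rule rothberger_select[where P = "\<lambda>_ V. \<exists>W k. Q n V W k", OF assms(2)]) (rule tube)
  then have "\<exists>V :: nat \<Rightarrow> nat \<Rightarrow> 'b set. \<forall>n. (\<forall>j. openin Z (V n j) \<and> (\<exists>W k. Q n (V n j) W k)) \<and> topspace Z \<subseteq> (\<Union>j. V n j)"
    by (intro choice allI)
  then obtain V :: "nat \<Rightarrow> nat \<Rightarrow> 'b set" where "\<forall>n. (\<forall>j. openin Z (V n j) \<and> (\<exists>W k. Q n (V n j) W k)) \<and>
    topspace Z \<subseteq> (\<Union>j. V n j)" ..
  then have V: "openin Z (V n j)" "\<exists>W k. Q n (V n j) W k" "topspace Z \<subseteq> (\<Union>j. V n j)" for n j
    by simp_all
  define W where "W n j = (SOME W. \<exists>k. Q n (V n j) W k)" for n j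
  define \<kappa> where "\<kappa> n j = (SOME k. Q n (V n j) (W n j) k)" for n j
  have "\<exists>k. Q n (V n j) (W n j) k" for n j
    unfolding W_def by (rule someI_ex[OF V(2)])
  then have "Q n (V n j) (W n j) (\<kappa> n j)" for n j
    unfolding \<kappa>_def by (rule someI_ex)
  then have W: "openin X (W n j)" "K \<subseteq> W n j" "W n j \<times> V n j \<subseteq> (\<Union>i\<le>\<kappa> n j. U n i)" for n j
    unfolding Q_def by simp_all
  obtain g where g: "\<forall>z\<in>topspace Z. finite {n. z \<notin> (\<Union>k\<le>g n. V n k)}"
    using assms(3)[unfolded hurewicz_def, rule_format, of V] V(1,3) by blast
  define G where "G = (\<Inter>(n, j). W n j)"
  define g' where "g' n = Max (\<kappa> n ` {..g n})" for n
  have "gdelta_in X G"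
    unfolding G_def using W(1) by (intro gdelta_in_Inter) (auto simp: open_imp_gdelta_in)
  moreover have "K \<subseteq> G"
    unfolding G_def using W(2) by auto
  moreover have "finite {n. (x, z) \<notin> (\<Union>k\<le>g' n. U n k)}" if x: "x \<in> G" and z: "z \<in> topspace Z" for x z
  proof (rule finite_subset)
    show "finite {n. z \<notin> (\<Union>k\<le>g n. V n k)}"
      using g z by blast
    have "(x, z) \<in> (\<Union>k\<le>g' n. U n k)" if n: "z \<in> (\<Union>k\<le>g n. V n k)" for n
    proof -
      obtain j where j: "j \<le> g n" "z \<in> V n j"
        using n by blast
      have "x \<in> W n j"
        using x unfolding G_def by auto
      with j(2) have "(x, z) \<in> W n j \<times> V n j"
        by simp
      then have "(x, z) \<in> (\<Union>i\<le>\<kappa> n j. U n i)"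
        by (rule subsetD[OF W(3)])
      moreover have "\<kappa> n j \<le> g' n"
        unfolding g'_def using j(1) by simp
      then have "(\<Union>i\<le>\<kappa> n j. U n i) \<subseteq> (\<Union>i\<le>g' n. U n i)"
        by (intro UN_mono) auto
      ultimately show ?thesis
        by (rule subsetD[rotated])
    qed
    then show "{n. (x, z) \<notin> (\<Union>k\<le>g' n. U n k)} \<subseteq> {n. z \<notin> (\<Union>k\<le>g n. V n k)}"
      by blast
  qed
  ultimately show ?thesis
    by (intro exI[of _ G] conjI exI[of _ g'] ballI)
qed

text \<open>All \<open>G i\<close> share the same covers: \<open>h\<close> dominates each
  \<open>g i\<close> from \<open>n = i\<close> on, so over \<open>G i\<close> only the finitely many
  \<open>n < i\<close> can be new exceptions.\<close>

lemma hurewicz_prod_topology: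
  fixes Z :: "'b topology"
  assumes "S1 (GK_covers X) (GGamma_covers X)" and "rothberger Z" and "hurewicz Z"
  shows "hurewicz (prod_topology X Z)"
  unfolding hurewicz_def
proof (intro allI impI, elim conjE)
  fix U :: "nat \<Rightarrow> nat \<Rightarrow> ('a \<times> 'b) set"
  assume U: "\<forall>n k. openin (prod_topology X Z) (U n k)"
    "\<forall>n. topspace (prod_topology X Z) \<subseteq> (\<Union>k. U n k)"
  define Q where "Q G g \<longleftrightarrow> (\<forall>x\<in>G. \<forall>z\<in>topspace Z. finite {n. (x, z) \<notin> (\<Union>k\<le>g n. U n k)})"
    for G and g :: "nat \<Rightarrow> nat"
  have Q: "\<exists>G. gdelta_in X G \<and> (\<exists>g. Q G g) \<and> K \<subseteq> G" if "compactin X K" for K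
    using hurewicz_cover_gdelta[OF that assms(2,3), of U] U unfolding Q_def by blast
  have "\<exists>G. (\<forall>i :: nat. \<exists>g. Q (G i) g) \<and> topspace X \<subseteq> (\<Union>i. G i)"
    by (rule GK_select[OF assms(1) Q])
  then obtain G where G: "(\<forall>i :: nat. \<exists>g. Q (G i) g) \<and> topspace X \<subseteq> (\<Union>i. G i)" ..
  then obtain g where g: "\<forall>i. Q (G i) (g i)"
    by (auto dest: choice)
  define h where "h n = Max ((\<lambda>i. g i n) ` {..n})" for n
  have "finite {n. p \<notin> (\<Union>k\<le>h n. U n k)}" if p: "p \<in> topspace (prod_topology X Z)" for p
  proof -
    obtain x z where xz: "p = (x, z)" "x \<in> topspace X" "z \<in> topspace Z"
      using p by auto
    then obtain i where i: "x \<in> G i"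
      using G by blast
    have "finite ({..<i} \<union> {n. p \<notin> (\<Union>k\<le>g i n. U n k)})"
      using g i xz unfolding Q_def by simp
    moreover have "{n. p \<notin> (\<Union>k\<le>h n. U n k)} \<subseteq> {..<i} \<union> {n. p \<notin> (\<Union>k\<le>g i n. U n k)}"
    proof
      fix n assume n: "n \<in> {n. p \<notin> (\<Union>k\<le>h n. U n k)}"
      show "n \<in> {..<i} \<union> {n. p \<notin> (\<Union>k\<le>g i n. U n k)}"
      proof (cases "n < i")
        case False
        then have "g i n \<le> h n"
          unfolding h_def by simp
        then have "(\<Union>k\<le>g i n. U n k) \<subseteq> (\<Union>k\<le>h n. U n k)"
          by (intro UN_mono) auto
        with n have "p \<notin> (\<Union>k\<le>g i n. U n k)"
          by (auto dest: subsetD)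
        then show ?thesis
          by simp
      qed simp
    qed
    ultimately show ?thesis
      by (rule finite_subset[rotated])
  qed
  then show "\<exists>g. \<forall>p\<in>topspace (prod_topology X Z). finite {n. p \<notin> (\<Union>k\<le>g n. U n k)}"
    by blast
qed

section \<open>Groupable covers and the Gerlits-Nagy property\<close>

text \<open>Every member of \<open>\<U>\<close> misses a point. A member that contains
  \<open>x\<close> and one missed point for each member in \<open>Q\<close> is itself outside
  \<open>Q\<close>.\<close>

lemma omega_covers_diff_finite:
  assumes "omega_covers X \<U>" and "finite Q"
  shows "open_covers X (\<U> - Q)"
proof -
  have *: "\<exists>p. p \<in> topspace X - q" if "q \<in> \<U>" for q
  proof -
    have "openin X q" "q \<noteq> topspace X"
      using assms(1) that by (auto simp: omega_covers_def open_covers_def)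
    then have "q \<subseteq> topspace X" "q \<noteq> topspace X"
      by (simp_all add: openin_subset)
    then show ?thesis
      by blast
  qed
  obtain p where p: "\<And>q. q \<in> \<U> \<Longrightarrow> p q \<in> topspace X - q"
    using * by metis
  have "x \<in> \<Union>(\<U> - Q)" if x: "x \<in> topspace X" for x
  proof -
    define F where "F = insert x (p ` (Q \<inter> \<U>))"
    have "finite F" "F \<subseteq> topspace X"
      using assms(2) x p by (auto simp: F_def)
    then obtain U where U: "U \<in> \<U>" "F \<subseteq> U"
      using assms(1) unfolding omega_covers_def by blast
    have "U \<notin> Q"
      using U p[of U] by (auto simp: F_def)
    with U show ?thesis
      by (auto simp: F_def)
  qed
  moreover have opn: "\<forall>U\<in>\<U>. openin X U"
    using assms(1) by (simp add: omega_covers_def open_covers_def)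
  then have "\<Union>(\<U> - Q) \<subseteq> topspace X"
    using openin_subset by blast
  ultimately show ?thesis
    unfolding open_covers_def using opn by (intro conjI subset_antisym) auto
qed

text \<open>Members in no group are distributed by an injection into the indices, at most one to a
  group; enlarging groups keeps the covering condition.\<close>

lemma gp_coversI:
  fixes P :: "nat \<Rightarrow> 'a set set"
  assumes "open_covers X \<U>" and "countable \<U>" and P: "\<And>n. finite (P n)" "\<And>n. P n \<subseteq> \<U>"
    "\<And>i j. i < j \<Longrightarrow> P i \<inter> P j = {}" "\<And>x. x \<in> topspace X \<Longrightarrow> finite {n. x \<notin> \<Union>(P n)}"
  shows "gp_covers X \<U>"
proof -
  define R where "R = \<U> - \<Union>(range P)"
  define P' where "P' n = P n \<union> {U \<in> R. to_nat_on R U = n}" for n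
  have inj: "inj_on (to_nat_on R) R"
    using assms(2) by (intro inj_on_to_nat_on) (simp add: R_def)
  have "finite (P' n)" for n
  proof -
    have "finite {U \<in> R. to_nat_on R U = n}"
      by (rule inj_on_finite[of "to_nat_on R" _ "{n}"]) (auto intro: inj_on_subset[OF inj])
    then show ?thesis
      using P(1) by (simp add: P'_def)
  qed
  moreover have "P' i \<inter> P' j = {}" if "i \<noteq> j" for i j
  proof -
    have "P i \<inter> P j = {}"
      using P(3)[of i j] P(3)[of j i] that by (cases i j rule: linorder_cases) auto
    then show ?thesis
      using that by (auto simp: P'_def R_def)
  qed
  moreover have "\<Union>(range P') = \<U>"
  proof
    show "\<Union>(range P') \<subseteq> \<U>"
      using P(2) by (auto simp: P'_def R_def)
    show "\<U> \<subseteq> \<Union>(range P')"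
    proof
      fix U assume "U \<in> \<U>"
      then have "(\<exists>n. U \<in> P n) \<or> U \<in> P' (to_nat_on R U)"
        by (auto simp: P'_def R_def)
      then show "U \<in> \<Union>(range P')"
        by (auto simp: P'_def)
    qed
  qed
  moreover have "finite {n. x \<notin> \<Union>(P' n)}" if "x \<in> topspace X" for x
    by (rule finite_subset[OF _ P(4)[OF that]]) (auto simp: P'_def)
  ultimately show ?thesis
    unfolding gp_covers_def using assms(1) by (intro conjI exI[of _ P'] allI impI ballI)
qed

text \<open>Stage \<open>i\<close> selects a whole cover of \<open>X\<close> from row
  \<open>i\<close> of the pairing, and an initial part of it becomes the \<open>i\<close>-th
  group.\<close>

lemma rothberger_hurewicz_imp_gerlits_nagy:
  assumes "rothberger X" and "hurewicz X"
  shows "gerlits_nagy X"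
  unfolding gerlits_nagy_def S1_def
proof (intro allI impI)
  fix U :: "nat \<Rightarrow> 'a set set"
  assume U: "\<forall>n. omega_covers X (U n)"
  define ok where "ok i Q b \<longleftrightarrow> (\<forall>m. b m \<in> U (prod_encode (i, m)) - Q) \<and> topspace X \<subseteq> (\<Union>m. b m)"
    for i :: nat and Q and b :: "nat \<Rightarrow> 'a set"
  define b where "b i Q = (SOME b. ok i Q b)" for i Q
  have ok: "ok i Q (b i Q)" if Q: "finite Q" for i Q
  proof -
    have "open_covers X (U (prod_encode (i, m)) - Q)" for m
      using U Q by (intro omega_covers_diff_finite) auto
    then obtain c where c: "\<forall>m. c m \<in> U (prod_encode (i, m)) - Q" "open_covers X (range c)"
      using assms(1)[unfolded rothberger_def S1_def, rule_format, of "\<lambda>m. U (prod_encode (i, m)) - Q"]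
      by blast
    then have "ok i Q c"
      unfolding ok_def open_covers_def by simp
    then show ?thesis
      unfolding b_def by (rule someI[of "ok i Q"])
  qed
  \<comment> \<open>The groups must be disjoint, so the selection at stage \<open>i\<close> avoids the finite set \<open>Q \<sigma>\<close> of sets
    used before, where \<open>\<sigma>\<close> lists (latest first) the sizes of the earlier groups. The Hurewicz
    property is applied to all the countably many \<open>\<sigma>\<close> at once, and the function obtained picks a
    branch of this tree.\<close>
  define Q where "Q = rec_list {} (\<lambda>k \<sigma> q. q \<union> b (length \<sigma>) q ` {..k})"
  have Q_simps: "Q [] = {}" "Q (k # \<sigma>) = Q \<sigma> \<union> b (length \<sigma>) (Q \<sigma>) ` {..k}" for k \<sigma>
    by (simp_all add: Q_def)
  have Q_finite: "finite (Q \<sigma>)" for \<sigma>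
    by (induction \<sigma>) (simp_all add: Q_simps)
  define c where "c \<sigma> = b (length \<sigma>) (Q \<sigma>)" for \<sigma>
  have c: "c \<sigma> m \<in> U (prod_encode (length \<sigma>, m))" "c \<sigma> m \<notin> Q \<sigma>" "topspace X \<subseteq> (\<Union>m. c \<sigma> m)" for \<sigma> m
    using ok[OF Q_finite, of "length \<sigma>" \<sigma>] unfolding ok_def c_def by simp_all
  have c_open: "openin X (c \<sigma> m)" for \<sigma> m
    using c(1)[of \<sigma> m] U unfolding omega_covers_def open_covers_def by blast
  obtain g where g: "\<forall>x\<in>topspace X. finite {n. x \<notin> (\<Union>k\<le>g n. c (from_nat n) k)}"
    using assms(2)[unfolded hurewicz_def, rule_format, of "\<lambda>n. c (from_nat n)"] c_open c(3) by blast
  define s where "s = rec_nat [] (\<lambda>i \<sigma>. g (to_nat \<sigma>) # \<sigma>)"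
  have s: "s 0 = []" "s (Suc i) = g (to_nat (s i)) # s i" for i
    by (simp_all add: s_def)
  have len: "length (s i) = i" for i
    by (induction i) (simp_all add: s)
  define P where "P i = c (s i) ` {..g (to_nat (s i))}" for i
  have Q_Suc: "Q (s (Suc i)) = Q (s i) \<union> P i" for i
    by (simp add: s Q_simps P_def c_def)
  have P_Q: "P i \<subseteq> Q (s j)" if "i < j" for i j
    using that by (induction j) (auto simp: Q_Suc less_Suc_eq)
  \<comment> \<open>The complete stage covers are kept, so that every \<open>U n\<close> is selected
    from; \<open>gp_coversI\<close> places the sets beyond the groups.\<close>
  define B where "B n = (case prod_decode n of (i, m) \<Rightarrow> c (s i) m)" for n
  have B_eq: "B (prod_encode (i, m)) = c (s i) m" for i m
    by (simp add: B_def)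
  have B: "B n \<in> U n" for n
    using c(1)[of "s (fst (prod_decode n))" "snd (prod_decode n)"]
    by (simp add: B_def case_prod_beta len)
  have "gp_covers X (range B)"
  proof (rule gp_coversI)
    have "openin X (B n)" for n
      by (simp add: B_def c_open case_prod_beta)
    moreover have "topspace X \<subseteq> \<Union>(range B)"
    proof
      fix x assume "x \<in> topspace X"
      then obtain m where "x \<in> c (s 0) m"
        using c(3)[of "s 0"] by blast
      then show "x \<in> \<Union>(range B)"
        unfolding B_eq[symmetric] by (rule UN_I[OF UNIV_I])
    qed
    ultimately show "open_covers X (range B)"
      unfolding open_covers_def using openin_subset by blast
    show "P i \<subseteq> range B" for i
      unfolding P_def B_eq[symmetric] by blast
    show "P i \<inter> P j = {}" if "i < j" for i j
      using P_Q[OF that] c(2)[of "s j"] by (auto simp: P_def)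
    show "finite {i. x \<notin> \<Union>(P i)}" if x: "x \<in> topspace X" for x
    proof -
      \<comment> \<open>Nodes of the branch differ in length, so finitely many exceptional nodes of
        the tree mean finitely many exceptional stages.\<close>
      have "inj (\<lambda>i. to_nat (s i))"
        by (rule injI) (metis from_nat_to_nat len)
      then have "finite ((\<lambda>i. to_nat (s i)) -` {n. x \<notin> (\<Union>k\<le>g n. c (from_nat n) k)})"
        using g x by (intro finite_vimageI) auto
      then show ?thesis
        by (simp add: vimage_def P_def)
    qed
  qed (auto simp: P_def)
  with B show "\<exists>B. (\<forall>n. B n \<in> U n) \<and> gp_covers X (range B)"
    by blast
qed

theorem theorem4p13:
  fixes X :: "'a topology"
  assumes "inf_T1_space X"
    and "rothberger X"
    and "S1 (GK_covers X) (GGamma_covers X)"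
  shows "(\<forall>Y :: 'b topology. inf_T1_space Y \<and> rothberger Y \<longrightarrow> rothberger (prod_topology X Y))
       \<and> (\<forall>Z :: 'c topology. inf_T1_space Z \<and> gerlits_nagy Z \<longrightarrow> gerlits_nagy (prod_topology X Z))"
proof (intro conjI allI impI; elim conjE)
  fix Y :: "'b topology" assume "rothberger Y"
  then show "rothberger (prod_topology X Y)"
    by (rule rothberger_prod_topology[OF assms(2,3)])
next
  fix Z :: "'c topology" assume "inf_T1_space Z" and Z: "gerlits_nagy Z"
  then have "topspace Z \<noteq> {}"
    unfolding inf_T1_space_def by auto
  with Z have roth: "rothberger Z"
    by (rule gerlits_nagy_imp_rothberger)
  show "gerlits_nagy (prod_topology X Z)"
  proof (rule rothberger_hurewicz_imp_gerlits_nagy)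
    show "rothberger (prod_topology X Z)"
      by (rule rothberger_prod_topology[OF assms(2,3) roth])
    show "hurewicz (prod_topology X Z)"
      using gerlits_nagy_imp_hurewicz[OF Z] by (rule hurewicz_prod_topology[OF assms(3) roth])
  qed
qed

end
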